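(* Let $\mathcal{H}=(\mathcal{U},\mathcal{E})$ be a finite dihypergraph, let $(\mathcal{U}_1,\mathcal{U}_2)$ be a split of $\mathcal{H}$, and let $\mathcal{F}_1$ and $\mathcal{F}_2$ be the closure systems of $\mathcal{H}[\mathcal{U}_1]$ and $\mathcal{H}[\mathcal{U}_2]$ respectively (on ground sets $\mathcal{U}_1$, $\mathcal{U}_2$). Then: (i) if $F\in\mathcal{F}_{\mathcal{H}}$ then $F\cap\mathcal{U}_i\in\mathcal{F}_i$ for $i\in\{1,2\}$; moreover $\mathcal{F}_{\mathcal{H}}\subseteq\mathcal{F}_1\times\mathcal{F}_2$; (ii) if $\mathcal{H}[\mathcal{U}_1,\mathcal{U}_2]$ has no edge, then $\mathcal{F}_{\mathcal{H}}=\mathcal{F}_1\times\mathcal{F}_2$; (iii) if every edge $(B,h)$ of $\mathcal{H}[\mathcal{U}_1,\mathcal{U}_2]$ satisfies $B\subseteq\mathcal{U}_1$, then $\mathcal{F}_{\mathcal{H}}:\mathcal{U}_1=\mathcal{F}_1$ and $\mathcal{F}_{\mathcal{H}}:\mathcal{U}_2=\mathcal{F}_2$; (iv) if every edge $(B,h)$ of $\mathcal{H}[\mathcal{U}_1,\mathcal{U}_2]$ satisfies $B\subseteq\mathcal{U}_2$, then $\mathcal{F}_{\mathcal{H}}:\mathcal{U}_2=\mathcal{F}_2$ and $\mathcal{F}_{\mathcal{H}}:\mathcal{U}_1=\mathcal{F}_1$.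
   Context: A dihypergraph $\mathcal{H}=(\mathcal{U},\mathcal{E})$ consists of a finite vertex set $\mathcal{U}$ and a finite set $\mathcal{E}$ of edges; each edge is a pair $(B,h)$ with $B\subseteq\mathcal{U}$ and $h\in\mathcal{U}\setminus B$; an edge is identified with $B\cup\{h\}$ for containment. For $U\subseteq\mathcal{U}$, $\mathcal{H}[U]=(U,\{e\in\mathcal{E}: e\subseteq U\})$. A split of $\mathcal{H}$ is a bipartition $(\mathcal{U}_1,\mathcal{U}_2)$ of $\mathcal{U}$ into nonempty parts such that every edge's body is contained in $\mathcal{U}_1$ or in $\mathcal{U}_2$; $\mathcal{H}[\mathcal{U}_1,\mathcal{U}_2]$ denotes the bipartite dihypergraph on $\mathcal{U}$ with edge set $\{e\in\mathcal{E}: e\not\subseteq\mathcal{U}_1\text{ and }e\not\subseteq\mathcal{U}_2\}$. The closure system of a dihypergraph $\mathcal{G}=(V,\mathcal{E}')$ is $\mathcal{F}_{\mathcal{G}}=\{F\subseteq V:\text{for every }(B,h)\in\mathcal{E}',\ B\subseteq F\Rightarrow h\in F\}$ (equivalently the set of fixed points of forward chaining). For a family $\mathcal{F}$ of subsets and a set $U$, the trace is $\mathcal{F}:U=\{F\cap U: F\in\mathcal{F}\}$. The product of two families is $\mathcal{F}_1\times\mathcal{F}_2=\{F_1\cup F_2: F_1\in\mathcal{F}_1,F_2\in\mathcal{F}_2\}$.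
   Formalization: The second equality in (iii) is proved assuming no edge contained in U_1 has an empty body, and that in (iv) assuming the same for U_2; with empty bodies allowed it fails, e.g. for edges (∅,a), ({a},b) with U_1={a}, U_2={b}. *)

theory Defs
  imports Main
begin

record 'a dihypergraph =
  verts :: "'a set"
  edges :: "('a set \<times> 'a) set"

abbreviation body :: "'a set \<times> 'a \<Rightarrow> 'a set" where
  "body \<equiv> fst"

abbreviation head :: "'a set \<times> 'a \<Rightarrow> 'a" where
  "head \<equiv> snd"

definition edge_support :: "'a set \<times> 'a \<Rightarrow> 'a set" where
  "edge_support e = body e \<union> {head e}"

(* Bodies may be empty: this is not excluded by the notion of edge used here. *)
definition dihypergraph :: "'a dihypergraph \<Rightarrow> bool" where
  "dihypergraph H \<longleftrightarrow> finite (verts H) \<and> finite (edges H) \<and>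
     (\<forall>e\<in>edges H. body e \<subseteq> verts H \<and> head e \<in> verts H - body e)"

definition induced :: "'a dihypergraph \<Rightarrow> 'a set \<Rightarrow> 'a dihypergraph" where
  "induced H U = \<lparr>verts = U, edges = {e \<in> edges H. edge_support e \<subseteq> U}\<rparr>"

definition is_split :: "'a dihypergraph \<Rightarrow> 'a set \<Rightarrow> 'a set \<Rightarrow> bool" where
  "is_split H U1 U2 \<longleftrightarrow> U1 \<union> U2 = verts H \<and> U1 \<inter> U2 = {} \<and> U1 \<noteq> {} \<and> U2 \<noteq> {} \<and>
     (\<forall>e\<in>edges H. body e \<subseteq> U1 \<or> body e \<subseteq> U2)"

definition bipartite_part :: "'a dihypergraph \<Rightarrow> 'a set \<Rightarrow> 'a set \<Rightarrow> 'a dihypergraph" where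
  "bipartite_part H U1 U2 = \<lparr>verts = verts H,
     edges = {e \<in> edges H. \<not> edge_support e \<subseteq> U1 \<and> \<not> edge_support e \<subseteq> U2}\<rparr>"

definition closure_system :: "'a dihypergraph \<Rightarrow> 'a set set" where
  "closure_system G = {F. F \<subseteq> verts G \<and> (\<forall>e\<in>edges G. body e \<subseteq> F \<longrightarrow> head e \<in> F)}"

definition trace :: "'a set set \<Rightarrow> 'a set \<Rightarrow> 'a set set" where
  "trace \<F> U = {F \<inter> U | F. F \<in> \<F>}"

definition family_product :: "'a set set \<Rightarrow> 'a set set \<Rightarrow> 'a set set" where
  "family_product \<F>1 \<F>2 = {F1 \<union> F2 | F1 F2. F1 \<in> \<F>1 \<and> F2 \<in> \<F>2}"

(* The usual convention that dihypergraph edges have nonempty bodies is kept as a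
   separate condition, so that it can be required only where it is needed.  For
   instance, with edges ({}, a) and ({a}, b), U1 = {a} and U2 = {b}, every edge
   between the parts has its body in U1, but the only closed set is {a, b}, whose
   trace {{b}} on U2 differs from the closure system {{}, {b}} of the part U2. *)
definition nonempty_bodies :: "'a dihypergraph \<Rightarrow> bool" where
  "nonempty_bodies G \<longleftrightarrow> (\<forall>e\<in>edges G. body e \<noteq> {})"

end

theory Submission
  imports Defs
begin

text \<open>
  A union of closed sets of the two parts satisfies every edge lying inside a part, so only the
  edges between the parts can obstruct closedness in the whole dihypergraph. If their bodies all
  lie in \<open>U1\<close>, their heads lie in \<open>U2\<close>: a closed set \<open>F\<close> of \<open>U1\<close> then extends to the closed set
  \<open>F \<union> U2\<close>, while a closed set of \<open>U2\<close> is itself closed, as its elements trigger no edge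
  with nonempty body in \<open>U1\<close>.
\<close>

lemma is_split_commute: "is_split H U1 U2 \<longleftrightarrow> is_split H U2 U1"
  unfolding is_split_def by blast

lemma bipartite_part_commute: "bipartite_part H U1 U2 = bipartite_part H U2 U1"
  unfolding bipartite_part_def by auto

lemma traceI: "F \<in> \<F> \<Longrightarrow> F \<inter> U = G \<Longrightarrow> G \<in> trace \<F> U"
  unfolding trace_def by blast

text \<open>For an edge supported in \<open>U\<close>, closedness of \<open>F\<close> puts the head
  in \<open>F\<close>, and the support condition puts it in \<open>U\<close>.\<close>

lemma closure_system_Int_induced:
  assumes "F \<in> closure_system H"
  shows "F \<inter> U \<in> closure_system (induced H U)"
  using assms unfolding closure_system_def induced_def edge_support_def by fastforce

lemma trace_closure_system_subset:
  "trace (closure_system H) U \<subseteq> closure_system (induced H U)"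
  unfolding trace_def using closure_system_Int_induced by blast

lemma verts_in_closure_system_induced: "U \<in> closure_system (induced H U)"
  unfolding closure_system_def induced_def edge_support_def by auto

text \<open>Only an edge with empty body can fire on the empty set. This is where the condition on
  bodies enters the proof.\<close>

lemma empty_in_closure_system: "nonempty_bodies G \<Longrightarrow> {} \<in> closure_system G"
  unfolding closure_system_def nonempty_bodies_def by auto

lemma closure_system_induced_subset: "F \<in> closure_system (induced H U) \<Longrightarrow> F \<subseteq> U"
  unfolding closure_system_def induced_def by simp

lemma closure_system_subset_family_product:
  assumes "is_split H U1 U2"
  shows "closure_system H \<subseteq>
    family_product (closure_system (induced H U1)) (closure_system (induced H U2))"
proof
  fix F assume F: "F \<in> closure_system H"
  then have "F \<subseteq> U1 \<union> U2"
    using assms unfolding closure_system_def is_split_def by blast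
  then have "F = (F \<inter> U1) \<union> (F \<inter> U2)" by blast
  with closure_system_Int_induced[OF F]
  show "F \<in> family_product (closure_system (induced H U1)) (closure_system (induced H U2))"
    unfolding family_product_def by blast
qed

text \<open>The premise \<open>cross\<close> can be met in two ways: by having the heads in the
  union, or by showing that no body of an edge between the parts fits into it. The two trace lemmas
  below use one way each.\<close>

lemma Un_in_closure_system:
  assumes split: "is_split H U1 U2"
    and F1: "F1 \<in> closure_system (induced H U1)"
    and F2: "F2 \<in> closure_system (induced H U2)"
    and cross: "\<And>e. e \<in> edges (bipartite_part H U1 U2) \<Longrightarrow> body e \<subseteq> F1 \<union> F2 \<Longrightarrow>
      head e \<in> F1 \<union> F2"
  shows "F1 \<union> F2 \<in> closure_system H"
proof -
  have sub: "F1 \<subseteq> U1" "F2 \<subseteq> U2"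
    using F1 F2 closure_system_induced_subset by blast+
  have disj: "U1 \<inter> U2 = {}" and verts: "U1 \<union> U2 = verts H"
    using split unfolding is_split_def by auto
  have "head e \<in> F1 \<union> F2" if e: "e \<in> edges H" and b: "body e \<subseteq> F1 \<union> F2" for e
  proof -
    consider "edge_support e \<subseteq> U1" | "edge_support e \<subseteq> U2"
      | "e \<in> edges (bipartite_part H U1 U2)"
      using e unfolding bipartite_part_def by auto
    then show ?thesis
    proof cases
      case 1
      \<comment> \<open>The body lies in \<open>U1\<close>, hence misses \<open>F2\<close>, which
        lies in the disjoint set \<open>U2\<close>.\<close>
      then have "body e \<subseteq> F1"
        using b sub disj unfolding edge_support_def by blast
      then show ?thesis
        using 1 e F1 unfolding closure_system_def induced_def by (cases e) auto
    next
      case 2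
      then have "body e \<subseteq> F2"
        using b sub disj unfolding edge_support_def by blast
      then show ?thesis
        using 2 e F2 unfolding closure_system_def induced_def by (cases e) auto
    next
      case 3
      then show ?thesis using cross b by blast
    qed
  qed
  then show ?thesis
    using sub verts unfolding closure_system_def by auto
qed

lemma closure_system_eq_family_product:
  assumes "is_split H U1 U2" and "edges (bipartite_part H U1 U2) = {}"
  shows "closure_system H =
    family_product (closure_system (induced H U1)) (closure_system (induced H U2))"
proof
  show "family_product (closure_system (induced H U1)) (closure_system (induced H U2))
    \<subseteq> closure_system H"
    using Un_in_closure_system[OF assms(1)] assms(2) unfolding family_product_def by auto
qed (rule closure_system_subset_family_product[OF assms(1)])

text \<open>A head in \<open>U1\<close> would put the whole edge inside \<open>U1\<close>. With an
  empty body the support would be a single vertex, which lies in one of the parts. So edges between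
  the parts have nonempty bodies automatically, and the condition on bodies concerns only edges
  inside a part.\<close>

lemma bipartite_part_edge:
  assumes "dihypergraph H" and "is_split H U1 U2"
    and "e \<in> edges (bipartite_part H U1 U2)" and "body e \<subseteq> U1"
  shows "head e \<in> U2" and "body e \<noteq> {}"
proof -
  have "e \<in> edges H" "\<not> edge_support e \<subseteq> U1" "\<not> edge_support e \<subseteq> U2"
    using assms(3) unfolding bipartite_part_def by auto
  moreover from this have "head e \<in> U1 \<union> U2"
    using assms(1,2) unfolding dihypergraph_def is_split_def by auto
  ultimately show "head e \<in> U2" and "body e \<noteq> {}"
    using assms(4) unfolding edge_support_def by auto
qed

lemma trace_closure_system_body_side:
  assumes "dihypergraph H" and "is_split H U1 U2"
    and "\<forall>e \<in> edges (bipartite_part H U1 U2). body e \<subseteq> U1"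
  shows "trace (closure_system H) U1 = closure_system (induced H U1)"
proof
  show "closure_system (induced H U1) \<subseteq> trace (closure_system H) U1"
  proof
    fix F assume F: "F \<in> closure_system (induced H U1)"
    \<comment> \<open>Taking all of \<open>U2\<close>, the largest closed set there, absorbs every
      head of an edge between the parts.\<close>
    have "F \<union> U2 \<in> closure_system H"
      using Un_in_closure_system[OF assms(2) F verts_in_closure_system_induced]
        bipartite_part_edge(1)[OF assms(1,2)] assms(3) by blast
    moreover have "(F \<union> U2) \<inter> U1 = F"
      using closure_system_induced_subset[OF F] assms(2) unfolding is_split_def by blast
    ultimately show "F \<in> trace (closure_system H) U1" by (rule traceI)
  qed
qed (rule trace_closure_system_subset)

text \<open>A closed set of \<open>U2\<close> is paired with the empty subset of \<open>U1\<close>,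
  which is closed because no edge inside \<open>U1\<close> has an empty body.\<close>

lemma trace_closure_system_head_side:
  assumes "dihypergraph H" and "is_split H U1 U2"
    and "\<forall>e \<in> edges (bipartite_part H U1 U2). body e \<subseteq> U1"
    and "nonempty_bodies (induced H U1)"
  shows "trace (closure_system H) U2 = closure_system (induced H U2)"
proof
  show "closure_system (induced H U2) \<subseteq> trace (closure_system H) U2"
  proof
    fix F assume F: "F \<in> closure_system (induced H U2)"
    have sub: "F \<subseteq> U2" by (rule closure_system_induced_subset[OF F])
    \<comment> \<open>A body inside both \<open>F\<close> and \<open>U1\<close> lies in both parts,
      so it is empty, which is impossible for an edge between them. Hence \<open>cross\<close> holds
      vacuously for the union of \<open>{}\<close> and \<open>F\<close>.\<close>
    have "\<not> body e \<subseteq> F" if e: "e \<in> edges (bipartite_part H U1 U2)" for e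
    proof
      assume "body e \<subseteq> F"
      moreover have "body e \<subseteq> U1" using assms(3) e by blast
      ultimately have "body e = {}"
        using sub assms(2) unfolding is_split_def by blast
      with bipartite_part_edge(2)[OF assms(1,2) e] show False by simp
    qed
    then have "F \<in> closure_system H"
      using Un_in_closure_system[OF assms(2) empty_in_closure_system[OF assms(4)] F] by auto
    then show "F \<in> trace (closure_system H) U2"
      using sub by (intro traceI[of F]) auto
  qed
qed (rule trace_closure_system_subset)

theorem theorem3:
  fixes H :: "'a dihypergraph" and U1 U2 :: "'a set"
  assumes "dihypergraph H"
    and "is_split H U1 U2"
  shows
    "((\<forall>F \<in> closure_system H. F \<inter> U1 \<in> closure_system (induced H U1) \<and>
                               F \<inter> U2 \<in> closure_system (induced H U2)) \<and>
      closure_system H \<subseteq>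
        family_product (closure_system (induced H U1)) (closure_system (induced H U2))) \<and>
     (edges (bipartite_part H U1 U2) = {} \<longrightarrow>
        closure_system H =
          family_product (closure_system (induced H U1)) (closure_system (induced H U2))) \<and>
     ((\<forall>e \<in> edges (bipartite_part H U1 U2). body e \<subseteq> U1) \<longrightarrow>
        trace (closure_system H) U1 = closure_system (induced H U1) \<and>
        (nonempty_bodies (induced H U1) \<longrightarrow>
           trace (closure_system H) U2 = closure_system (induced H U2))) \<and>
     ((\<forall>e \<in> edges (bipartite_part H U1 U2). body e \<subseteq> U2) \<longrightarrow>
        trace (closure_system H) U2 = closure_system (induced H U2) \<and>
        (nonempty_bodies (induced H U2) \<longrightarrow>
           trace (closure_system H) U1 = closure_system (induced H U1)))"
proof (intro conjI impI ballI)
  \<comment> \<open>With the split reversed, the last clause follows from the same two trace lemmas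
    with \<open>U1\<close> and \<open>U2\<close> exchanged.\<close>
  note split' = assms(2)[unfolded is_split_commute[of H U1]]
  show "F \<inter> U1 \<in> closure_system (induced H U1)" "F \<inter> U2 \<in> closure_system (induced H U2)"
    if "F \<in> closure_system H" for F
    using that by (rule closure_system_Int_induced)+
  show "closure_system H \<subseteq>
      family_product (closure_system (induced H U1)) (closure_system (induced H U2))"
    by (rule closure_system_subset_family_product[OF assms(2)])
  show "closure_system H =
      family_product (closure_system (induced H U1)) (closure_system (induced H U2))"
    if "edges (bipartite_part H U1 U2) = {}"
    by (rule closure_system_eq_family_product[OF assms(2) that])
  {
    assume U1: "\<forall>e \<in> edges (bipartite_part H U1 U2). body e \<subseteq> U1"
    show "trace (closure_system H) U1 = closure_system (induced H U1)"
      by (rule trace_closure_system_body_side[OF assms U1])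
    show "trace (closure_system H) U2 = closure_system (induced H U2)"
      if "nonempty_bodies (induced H U1)"
      by (rule trace_closure_system_head_side[OF assms U1 that])
  }
  {
    assume "\<forall>e \<in> edges (bipartite_part H U1 U2). body e \<subseteq> U2"
    then have U2: "\<forall>e \<in> edges (bipartite_part H U2 U1). body e \<subseteq> U2"
      by (simp add: bipartite_part_commute)
    show "trace (closure_system H) U2 = closure_system (induced H U2)"
      by (rule trace_closure_system_body_side[OF assms(1) split' U2])
    show "trace (closure_system H) U1 = closure_system (induced H U1)"
      if "nonempty_bodies (induced H U2)"
      by (rule trace_closure_system_head_side[OF assms(1) split' U2 that])
  }
qed

end
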